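(* Let $\mathcal X,\mathcal A,\mathrm{vbl},\mathrm{rsp},\mathrm{stc},\Gamma,\prec$ be as in the setting described in the context. Suppose there are functions $P^*:\mathcal A\to(0,1)$ and $z:\mathcal A\to(0,1)$ such that, for each $A\in\mathcal A$, $$P^*(A)\ \ge\ \sup_{\mu\in\mathcal E_A}\Pr(A\mid E_\mu)\qquad\text{and}\qquad P^*(A)\ \le\ z(A)\prod_{B\in\Gamma(A)}\bigl(1-z(B)\bigr).$$ Then, for any finite set of events $\mathcal B\subset\mathcal A$, the stopping time $t_{\mathcal B}$, defined as the first stage $n$ of the modified resample algorithm at which all $B\in\mathcal B$ are false (under the valuation $R_n$), has finite expectation.
   Context: Setting. $\mathcal X$ is a countable set of mutually independent random variables with finite ranges. $\mathcal A$ is a countable set of events in the sigma-algebra $\sigma(\mathcal X)$; each $A\in\mathcal A$ comes with a finite set $\mathrm{vbl}(A)\subset\mathcal X$ with $A\in\sigma(\mathrm{vbl}(A))$ (so the truth of $A$ is determined by the values of the variables in $\mathrm{vbl}(A)$) and a chosen subset $\mathrm{rsp}(A)\subset\mathrm{vbl}(A)$ (the variables resampled when $A$ is bad). Put $\mathrm{stc}(A)=\mathrm{vbl}(A)\setminus\mathrm{rsp}(A)$ (static variables), $\Gamma(A)=\{B\in\mathcal A: B\ne A,\ \mathrm{rsp}(A)\cap\mathrm{rsp}(B)\neq\emptyset\}$ and $\Gamma^+(A)=\Gamma(A)\cup\{A\}$. $\prec$ is a linear order on $\mathcal A$ of type $\omega$ such that for all $A,B,C\in\mathcal A$: if $A\in\Gamma^+(B)$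 and $A\notin\Gamma^+(C)$, then $C\succ B$ implies $C\succ A$. Write $A\ll B$ (equivalently $B\gg A$) if $A\prec B$ and $A\notin\Gamma(B)$. It is also required that $A\gg B$ implies $\mathrm{rsp}(A)\cap\mathrm{vbl}(B)=\emptyset$. $\mathcal E_A$ is the set of valuations of $\mathrm{stc}(A)$ (assignments to each variable in $\mathrm{stc}(A)$ of a value in its range). For a valuation $\mu$ of a set $S$ of variables, $E_\mu$ is the event that each $x\in S$ takes the value $\mu(x)$. Conditional probabilities $\Pr(A\mid E_\mu)$ are considered only for $\mu$ with $\Pr(E_\mu)>0$. Modified resample algorithm: it produces valuations $R_0,R_1,\dots$ of $\mathcal X$ and a log $E_1,E_2,\dots$ of events of $\mathcal A$. Stage $0$: $R_0(x)$, $x\in\mathcal X$, are mutually independent random samples of the variables. Stage $n+1$: let $A$ be the $\prec$-least event in $\mathcal A$ which is true under $R_n$; if there is none, halt. Otherwise set $E_{n+1}=A$; for each $x\in\mathrm{rsp}(A)$ let $R_{n+1}(x)$ be a fresh random sample of $x$, independent of all samples taken so far; for $x\in\mathcal X\setminus\mathrm{rsp}(A)$ let $R_{n+1}(x)=R_n(x)$. *)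

theory Defs
  imports "HOL-Probability.Probability"
begin

text \<open>
  The random variables are a family \<open>X\<close>, indexed by a set \<open>\<X>\<close>, on a probability space \<open>M\<close>.
  Events are subsets of \<open>space M\<close>.
\<close>

definition sigma_vars :: "'w measure \<Rightarrow> ('x \<Rightarrow> 'w \<Rightarrow> 'v) \<Rightarrow> 'x set \<Rightarrow> 'w set set" where
  "sigma_vars M X V = sigma_sets (space M) {X x -` S \<inter> space M | x S. x \<in> V}"

definition stc :: "('w set \<Rightarrow> 'x set) \<Rightarrow> ('w set \<Rightarrow> 'x set) \<Rightarrow> 'w set \<Rightarrow> 'x set" where
  "stc vbl rsp A = vbl A - rsp A"

definition nbhd :: "'w set set \<Rightarrow> ('w set \<Rightarrow> 'x set) \<Rightarrow> 'w set \<Rightarrow> 'w set set" where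
  "nbhd \<A> rsp A = {B \<in> \<A>. B \<noteq> A \<and> rsp A \<inter> rsp B \<noteq> {}}"

definition nbhd_plus :: "'w set set \<Rightarrow> ('w set \<Rightarrow> 'x set) \<Rightarrow> 'w set \<Rightarrow> 'w set set" where
  "nbhd_plus \<A> rsp A = nbhd \<A> rsp A \<union> {A}"

text \<open>\<open>(A, B) \<in> prec\<close> means that \<open>A\<close> strictly precedes \<open>B\<close>.\<close>

definition far_below ::
    "'w set set \<Rightarrow> ('w set \<Rightarrow> 'x set) \<Rightarrow> 'w set rel \<Rightarrow> 'w set \<Rightarrow> 'w set \<Rightarrow> bool" where
  "far_below \<A> rsp prec A B \<longleftrightarrow> (A, B) \<in> prec \<and> A \<notin> nbhd \<A> rsp B"

text \<open>
  In \<open>prec_omega\<close>, finiteness of all initial segments says that the order type is \<open>\<omega>\<close>, or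
  finite in case \<open>\<A>\<close> is finite.
\<close>

locale resample_setting = prob_space M
  for M :: "'w measure" +
  fixes X :: "'x \<Rightarrow> 'w \<Rightarrow> 'v" and \<X> :: "'x set"
    and \<A> :: "'w set set" and vbl rsp :: "'w set \<Rightarrow> 'x set" and prec :: "'w set rel"
  assumes countable_vars: "countable \<X>"
    and indep: "indep_vars (\<lambda>_. count_space UNIV) X \<X>"
    and finite_range: "\<And>x. x \<in> \<X> \<Longrightarrow> finite (X x ` space M)"
    and countable_events: "countable \<A>"
    and finite_vbl: "\<And>A. A \<in> \<A> \<Longrightarrow> finite (vbl A)"
    and vbl_subset: "\<And>A. A \<in> \<A> \<Longrightarrow> vbl A \<subseteq> \<X>"
    and event_sigma: "\<And>A. A \<in> \<A> \<Longrightarrow> A \<in> sigma_vars M X (vbl A)"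
    and rsp_subset: "\<And>A. A \<in> \<A> \<Longrightarrow> rsp A \<subseteq> vbl A"
    and prec_subset: "prec \<subseteq> \<A> \<times> \<A>"
    and prec_linear: "strict_linear_order_on \<A> prec"
    and prec_omega: "\<And>A. A \<in> \<A> \<Longrightarrow> finite {B \<in> \<A>. (B, A) \<in> prec}"
    and prec_nbhd: "\<And>A B C. A \<in> \<A> \<Longrightarrow> B \<in> \<A> \<Longrightarrow> C \<in> \<A> \<Longrightarrow>
          A \<in> nbhd_plus \<A> rsp B \<Longrightarrow> A \<notin> nbhd_plus \<A> rsp C \<Longrightarrow> (B, C) \<in> prec \<Longrightarrow> (A, C) \<in> prec"
    and far_disjoint: "\<And>A B. A \<in> \<A> \<Longrightarrow> B \<in> \<A> \<Longrightarrow>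
          far_below \<A> rsp prec B A \<Longrightarrow> rsp A \<inter> vbl B = {}"

definition valuations :: "'w measure \<Rightarrow> ('x \<Rightarrow> 'w \<Rightarrow> 'v) \<Rightarrow> 'x set \<Rightarrow> ('x \<Rightarrow> 'v) set" where
  "valuations M X S = (\<Pi>\<^sub>E x\<in>S. X x ` space M)"

definition val_event :: "'w measure \<Rightarrow> ('x \<Rightarrow> 'w \<Rightarrow> 'v) \<Rightarrow> 'x set \<Rightarrow> ('x \<Rightarrow> 'v) \<Rightarrow> 'w set" where
  "val_event M X S \<mu> = {\<omega> \<in> space M. \<forall>x\<in>S. X x \<omega> = \<mu> x}"

definition sup_cond_prob ::
    "'w measure \<Rightarrow> ('x \<Rightarrow> 'w \<Rightarrow> 'v) \<Rightarrow> 'x set \<Rightarrow> 'w set \<Rightarrow> real" where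
  "sup_cond_prob M X S A =
     (SUP \<mu> \<in> {\<mu> \<in> valuations M X S. measure M (val_event M X S \<mu>) > 0}.
        \<P>(\<omega> in M. \<omega> \<in> A \<bar> \<omega> \<in> val_event M X S \<mu>))"

text \<open>
  Unordered product over a possibly infinite set: the limit of the finite partial products along
  the directed set of finite subsets. The limit exists whenever all factors lie in \<open>[0, 1]\<close>, and
  for a finite index set this is the ordinary product.
\<close>

definition unordered_prod :: "('a \<Rightarrow> real) \<Rightarrow> 'a set \<Rightarrow> real" where
  "unordered_prod f I = Lim (finite_subsets_at_top I) (\<lambda>F. \<Prod>i\<in>F. f i)"

text \<open>
  Truth of an event under a valuation \<open>\<rho>\<close>. An event in \<open>sigma_vars M X (vbl A)\<close> is a union of
  fibres of the joint map of the variables in \<open>vbl A\<close>, so the choice of the witness \<open>\<omega>\<close>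
  does not matter.
\<close>

definition true_under ::
    "('x \<Rightarrow> 'w \<Rightarrow> 'v) \<Rightarrow> ('w set \<Rightarrow> 'x set) \<Rightarrow> ('x \<Rightarrow> 'v) \<Rightarrow> 'w set \<Rightarrow> bool" where
  "true_under X vbl \<rho> A \<longleftrightarrow> (\<exists>\<omega>\<in>A. \<forall>x\<in>vbl A. X x \<omega> = \<rho> x)"

definition least_true ::
    "('x \<Rightarrow> 'w \<Rightarrow> 'v) \<Rightarrow> 'w set set \<Rightarrow> ('w set \<Rightarrow> 'x set) \<Rightarrow> 'w set rel \<Rightarrow> ('x \<Rightarrow> 'v) \<Rightarrow>
     'w set option" where
  "least_true X \<A> vbl prec \<rho> =
     (if \<exists>A\<in>\<A>. true_under X vbl \<rho> A
      then Some (THE A. A \<in> \<A> \<and> true_under X vbl \<rho> A \<and>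
             (\<forall>B\<in>\<A>. true_under X vbl \<rho> B \<longrightarrow> B = A \<or> (A, B) \<in> prec))
      else None)"

text \<open>
  The run of the algorithm when \<open>s n x\<close> is the sample of variable \<open>x\<close> reserved for stage \<open>n\<close>;
  samples of variables that are not resampled at stage \<open>n\<close> are discarded. After halting, the
  valuation stays constant.
\<close>

primrec run ::
    "('x \<Rightarrow> 'w \<Rightarrow> 'v) \<Rightarrow> 'w set set \<Rightarrow> ('w set \<Rightarrow> 'x set) \<Rightarrow> ('w set \<Rightarrow> 'x set) \<Rightarrow> 'w set rel \<Rightarrow>
     (nat \<Rightarrow> 'x \<Rightarrow> 'v) \<Rightarrow> nat \<Rightarrow> 'x \<Rightarrow> 'v" where
  "run X \<A> vbl rsp prec s 0 = s 0"
| "run X \<A> vbl rsp prec s (Suc n) =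
     (case least_true X \<A> vbl prec (run X \<A> vbl rsp prec s n) of
        None \<Rightarrow> run X \<A> vbl rsp prec s n
      | Some A \<Rightarrow> (\<lambda>x. if x \<in> rsp A then s (Suc n) x else run X \<A> vbl rsp prec s n x))"

text \<open>The value is \<open>\<infinity>\<close> if there is no such stage.\<close>

definition stop_time ::
    "('x \<Rightarrow> 'w \<Rightarrow> 'v) \<Rightarrow> 'w set set \<Rightarrow> ('w set \<Rightarrow> 'x set) \<Rightarrow> ('w set \<Rightarrow> 'x set) \<Rightarrow> 'w set rel \<Rightarrow>
     'w set set \<Rightarrow> (nat \<Rightarrow> 'x \<Rightarrow> 'v) \<Rightarrow> enat" where
  "stop_time X \<A> vbl rsp prec \<B> s =
     (INF n \<in> {n. \<forall>B\<in>\<B>. \<not> true_under X vbl (run X \<A> vbl rsp prec s n) B}. enat n)"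

text \<open>
  On the probability space \<open>N\<close> that drives the algorithm, \<open>T n x\<close> are independent samples of the
  variables, one for each stage and each variable.
\<close>

definition independent_samples ::
    "'w measure \<Rightarrow> ('x \<Rightarrow> 'w \<Rightarrow> 'v) \<Rightarrow> 'x set \<Rightarrow> 'u measure \<Rightarrow> (nat \<Rightarrow> 'x \<Rightarrow> 'u \<Rightarrow> 'v) \<Rightarrow> bool" where
  "independent_samples M X \<X> N T \<longleftrightarrow>
     prob_space.indep_vars N (\<lambda>_. count_space UNIV) (\<lambda>(n, x). T n x) (UNIV \<times> \<X>) \<and>
     (\<forall>n. \<forall>x\<in>\<X>. distr N (count_space UNIV) (T n x) = distr M (count_space UNIV) (X x))"

end

theory Submission
  imports Defs
begin

text \<open>
  Stages before \<open>t\<close> only resample events of the finite set \<open>C\<close> of all events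
  that lie in \<open>\<B>\<close> or precede a member of it. If \<open>A\<close> is resampled
  immediately after \<open>B\<close>, then \<open>A \<ll> B\<close> fails, since otherwise
  \<open>A\<close> would have been true, and smaller, when \<open>B\<close> was selected.
  Running the algorithm backwards from the valuation \<open>R\<^sub>n\<close>, one sees that a word
  \<open>A\<^sub>1 \<dots> A\<^sub>n\<close> is the log of the first \<open>n\<close> stages with
  probability at most \<open>P A\<^sub>1 \<cdots> P A\<^sub>n\<close>; no witness trees are needed.

  It remains to sum these products over all words in which no letter is followed by a letter
  \<open>\<ll>\<close> it. The possible successors of a letter form an up-closed subset
  \<open>D\<close> of \<open>C\<close>, and \<open>H D = \<Prod>A\<in>D. 1 / (1 - z A)\<close> bounds
  the sum over the words starting in \<open>D\<close>: the local condition bounds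
  \<open>P A\<close> times the value of \<open>H\<close> at the successors of \<open>A\<close> by
  \<open>z A\<close> times its value at \<open>{E \<in> C. A \<preceq> E}\<close>, and the sum
  of the latter over \<open>A \<in> D\<close> telescopes to \<open>H D - 1\<close>.
\<close>

section \<open>Products, saturated sets and independence\<close>

text \<open>For factors in [0, 1] the finite partial products decrease along the directed set, so
  the limit is their infimum. The local condition can thus be restricted to a finite part of a
  possibly infinite neighbourhood.\<close>

lemma unordered_prod_le:
  assumes f: "\<And>i. i \<in> I \<Longrightarrow> 0 \<le> f i \<and> f i \<le> 1" and F: "finite F" "F \<subseteq> I"
  shows "unordered_prod f I \<le> prod f F"
proof -
  define L where "L = (INF F\<in>{F. finite F \<and> F \<subseteq> I}. prod f F)"
  have bdd: "bdd_below (prod f ` {F. finite F \<and> F \<subseteq> I})"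
    using f by (intro bdd_belowI2[of _ 0]) (auto intro!: prod_nonneg)
  have L_le: "L \<le> prod f G" if "finite G" "G \<subseteq> I" for G
    unfolding L_def using that by (intro cINF_lower bdd) auto
  have "(prod f \<longlongrightarrow> L) (finite_subsets_at_top I)"
  proof (rule order_tendstoI)
    fix a assume "a < L"
    then have "a < prod f G" if "finite G" "G \<subseteq> I" for G
      using L_le[OF that] by linarith
    then show "eventually (\<lambda>G. a < prod f G) (finite_subsets_at_top I)"
      unfolding eventually_finite_subsets_at_top by (intro exI[of _ "{}"]) auto
  next
    fix a assume "L < a"
    then obtain G where G: "finite G" "G \<subseteq> I" "prod f G < a"
      unfolding L_def using bdd by (subst (asm) cINF_less_iff) auto
    have "prod f G' < a" if "finite G'" "G \<subseteq> G'" "G' \<subseteq> I" for G'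
    proof -
      have "prod f G' = prod f G * prod f (G' - G)"
        using that by (metis prod.subset_diff mult.commute)
      also have "\<dots> \<le> prod f G * 1"
        using f that G by (intro mult_left_mono prod_le_1 prod_nonneg) auto
      finally show ?thesis using G by simp
    qed
    then show "eventually (\<lambda>G. prod f G < a) (finite_subsets_at_top I)"
      unfolding eventually_finite_subsets_at_top using G by blast
  qed
  then have "unordered_prod f I = L"
    unfolding unordered_prod_def by (intro tendsto_Lim) auto
  then show ?thesis using L_le F by simp
qed

text \<open>The summand of \<open>A\<close> is the product over all elements of rank at least that
  of \<open>A\<close> minus the product over those of larger rank.\<close>

lemma telescoping_upper_products:
  fixes r :: "'a \<Rightarrow> nat" and g :: "'a \<Rightarrow> 'b::comm_ring_1"
  assumes "finite U" "inj_on r U"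
  shows "(\<Sum>A\<in>U. (g A - 1) * (\<Prod>C\<in>{C\<in>U. r A < r C}. g C)) = (\<Prod>C\<in>U. g C) - 1"
  using assms
proof (induction rule: finite_ranking_induct[where f = "\<lambda>x. - int (r x)"])
  \<comment> \<open>Negating the rank makes the induction insert elements from the top downwards: a
    new element lies below all previous ones and leaves their summands unchanged.\<close>
  case (insert x S)
  show ?case
  proof (cases "x \<in> S")
    case False
    then have lt: "r x < r y" if "y \<in> S" for y
      using insert.hyps(2)[OF that] insert.prems that
      by (metis False inj_on_contraD insertCI le_neq_implies_less neg_le_iff_le of_nat_le_iff)
    have eq: "{C\<in>insert x S. r x < r C} = S"
      using lt by auto
    have "{C\<in>insert x S. r A < r C} = {C\<in>S. r A < r C}" if "A \<in> S" for A
      using lt[OF that] by auto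
    then have "(\<Sum>A\<in>S. (g A - 1) * (\<Prod>C\<in>{C\<in>insert x S. r A < r C}. g C)) = prod g S - 1"
      using insert by (simp cong: sum.cong)
    then show ?thesis
      using False insert.hyps(1) by (simp only: sum.insert prod.insert eq not_False_eq_True) (simp add: algebra_simps)
  qed (use insert in \<open>simp add: insert_absorb\<close>)
qed simp

text \<open>The generators are unions of fibres of the variables in \<open>V\<close>, and
  complements and countable unions preserve this. It makes truth independent of the witness chosen
  in \<open>true_under\<close>.\<close>

lemma sigma_vars_fibre:
  assumes "A \<in> sigma_vars M X V" "\<omega> \<in> space M" "\<omega>' \<in> space M" "\<And>x. x \<in> V \<Longrightarrow> X x \<omega> = X x \<omega>'"
  shows "\<omega> \<in> A \<longleftrightarrow> \<omega>' \<in> A"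
  using assms(1) unfolding sigma_vars_def
  by (induction rule: sigma_sets.induct) (use assms(2-) in auto)

text \<open>Stated for an arbitrary probability space because it serves both the variables
  \<open>X\<close> on \<open>M\<close> and the table of samples \<open>T\<close> on
  \<open>N\<close>.\<close>

lemma (in prob_space) prob_val_event:
  assumes "indep_vars (\<lambda>_. count_space UNIV) X I" "finite J" "J \<subseteq> I"
  shows "prob (val_event M X J \<mu>) = (\<Prod>x\<in>J. prob {\<omega>\<in>space M. X x \<omega> = \<mu> x})"
proof (cases "J = {}")
  case False
  have "val_event M X J \<mu> = (\<Inter>x\<in>J. X x -` {\<mu> x} \<inter> space M)"
    using False by (auto simp: val_event_def)
  moreover have "X x -` {\<mu> x} \<inter> space M = {\<omega>\<in>space M. X x \<omega> = \<mu> x}" for x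
    by auto
  ultimately show ?thesis
    using indep_varsD[OF assms(1) False assms(2,3), of "\<lambda>x. {\<mu> x}"] by simp
qed (simp add: val_event_def prob_space)

lemma true_under_cong: "(\<And>x. x \<in> vbl A \<Longrightarrow> \<rho> x = \<sigma> x) \<Longrightarrow> true_under X vbl \<rho> A \<longleftrightarrow> true_under X vbl \<sigma> A"
  by (auto simp: true_under_def)

section \<open>The linear order and the least true event\<close>

context resample_setting
begin

text \<open>Finite initial segments make this a rank into the natural numbers, where least elements
  exist and the telescoping identity applies.\<close>

definition pos :: "'w set \<Rightarrow> nat" where
  "pos A = card {B\<in>\<A>. (B, A) \<in> prec}"

lemma prec_trans: "(A, B) \<in> prec \<Longrightarrow> (B, C) \<in> prec \<Longrightarrow> (A, C) \<in> prec"
  and prec_irrefl: "(A, A) \<notin> prec"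
  and prec_total: "A \<in> \<A> \<Longrightarrow> B \<in> \<A> \<Longrightarrow> A \<noteq> B \<Longrightarrow> (A, B) \<in> prec \<or> (B, A) \<in> prec"
  using prec_linear
  by (auto simp: strict_linear_order_on_def total_on_def irrefl_def dest: transD)

lemma pos_mono: "(A, B) \<in> prec \<Longrightarrow> pos A < pos B"
proof -
  assume AB: "(A, B) \<in> prec"
  then have "A \<in> {C\<in>\<A>. (C, B) \<in> prec}" "A \<notin> {C\<in>\<A>. (C, A) \<in> prec}"
    using prec_subset prec_irrefl by auto
  moreover have "{C\<in>\<A>. (C, A) \<in> prec} \<subseteq> {C\<in>\<A>. (C, B) \<in> prec}"
    using AB prec_trans by blast
  ultimately show ?thesis
    unfolding pos_def using prec_subset prec_omega[of B] AB by (intro psubset_card_mono) auto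
qed

lemma prec_iff_pos: "A \<in> \<A> \<Longrightarrow> B \<in> \<A> \<Longrightarrow> (A, B) \<in> prec \<longleftrightarrow> pos A < pos B"
  using pos_mono prec_total by (metis less_asym less_irrefl)

lemma inj_on_pos: "inj_on pos \<A>"
  using pos_mono prec_total by (intro inj_onI) (metis less_irrefl)

abbreviation least where "least \<equiv> least_true X \<A> vbl prec"

text \<open>This form eliminates the definite description, and its quantifier runs over a finite
  initial segment, which measurability needs later.\<close>

lemma least_eq_Some_iff:
  "least \<rho> = Some A \<longleftrightarrow> A \<in> \<A> \<and> true_under X vbl \<rho> A \<and>
     (\<forall>B\<in>{B\<in>\<A>. (B, A) \<in> prec}. \<not> true_under X vbl \<rho> B)"
proof (cases "\<exists>A\<in>\<A>. true_under X vbl \<rho> A")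
  case True
  define Q where "Q A \<longleftrightarrow> A \<in> \<A> \<and> true_under X vbl \<rho> A \<and>
     (\<forall>B\<in>\<A>. true_under X vbl \<rho> B \<longrightarrow> B = A \<or> (A, B) \<in> prec)" for A
  have Q_iff: "Q A \<longleftrightarrow> A \<in> \<A> \<and> true_under X vbl \<rho> A \<and>
     (\<forall>B\<in>{B\<in>\<A>. (B, A) \<in> prec}. \<not> true_under X vbl \<rho> B)" for A
    unfolding Q_def using prec_total prec_trans prec_irrefl by blast
  obtain A0 where "A0 \<in> \<A>" "true_under X vbl \<rho> A0"
    "\<And>B. B \<in> \<A> \<Longrightarrow> true_under X vbl \<rho> B \<Longrightarrow> pos A0 \<le> pos B"
    using ex_has_least_nat[of "\<lambda>A. A \<in> \<A> \<and> true_under X vbl \<rho> A" _ pos] True by blast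
  then have "Q A0"
    unfolding Q_iff using pos_mono by (auto simp: not_less[symmetric])
  moreover have "A = B" if "Q A" "Q B" for A B
    using that prec_trans prec_irrefl unfolding Q_def by blast
  ultimately have "(THE A. Q A) = A \<longleftrightarrow> Q A" for A
    by (metis the_equality)
  then show ?thesis
    using True unfolding Q_iff[symmetric] by (simp add: least_true_def Q_def)
qed (auto simp: least_true_def)

lemma least_eq_None_iff: "least \<rho> = None \<longleftrightarrow> (\<forall>A\<in>\<A>. \<not> true_under X vbl \<rho> A)"
  by (auto simp: least_true_def)

lemma events_sets: "A \<in> \<A> \<Longrightarrow> A \<in> sets M"
proof -
  assume A: "A \<in> \<A>"
  have "sigma_sets (space M) {X x -` S \<inter> space M |x S. x \<in> vbl A} \<subseteq> sets M"
    using indep vbl_subset[OF A]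
    by (intro sets.sigma_sets_subset) (auto simp: indep_vars_def intro!: measurable_sets)
  then show ?thesis
    using event_sigma[OF A] unfolding sigma_vars_def by auto
qed

lemma true_under_range: "A \<in> \<A> \<Longrightarrow> true_under X vbl \<rho> A \<Longrightarrow> x \<in> vbl A \<Longrightarrow> \<rho> x \<in> X x ` space M"
  using sets.sets_into_space[OF events_sets] unfolding true_under_def by (metis imageI subsetD)

lemma val_event_subset_true:
  assumes "A \<in> \<A>" "true_under X vbl \<rho> A"
  shows "val_event M X (vbl A) \<rho> \<subseteq> A"
proof
  fix \<omega> assume \<omega>: "\<omega> \<in> val_event M X (vbl A) \<rho>"
  obtain \<omega>' where \<omega>': "\<omega>' \<in> A" "\<And>x. x \<in> vbl A \<Longrightarrow> X x \<omega>' = \<rho> x"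
    using assms(2) by (auto simp: true_under_def)
  have "\<omega>' \<in> A \<longleftrightarrow> \<omega> \<in> A"
    by (rule sigma_vars_fibre[OF event_sigma[OF assms(1)]])
      (use \<omega> \<omega>' sets.sets_into_space[OF events_sets[OF assms(1)]] in \<open>auto simp: val_event_def\<close>)
  with \<omega>'(1) show "\<omega> \<in> A" by simp
qed

section \<open>Probabilities of valuations and one backward step\<close>

definition weight :: "'x \<Rightarrow> 'v \<Rightarrow> real" where
  "weight x v = prob {\<omega>\<in>space M. X x \<omega> = v}"

lemma weight_nonneg: "0 \<le> weight x v"
  by (simp add: weight_def)

lemma prob_val_event_eq:
  "finite J \<Longrightarrow> J \<subseteq> \<X> \<Longrightarrow> prob (val_event M X J \<mu>) = (\<Prod>x\<in>J. weight x (\<mu> x))"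
  unfolding weight_def by (rule prob_val_event[OF indep])

lemma val_event_sets: "finite J \<Longrightarrow> J \<subseteq> \<X> \<Longrightarrow> val_event M X J \<mu> \<in> sets M"
proof -
  assume J: "finite J" "J \<subseteq> \<X>"
  have [measurable]: "X x \<in> measurable M (count_space UNIV)" if "x \<in> J" for x
    using indep that J by (auto simp: indep_vars_def)
  show ?thesis
    unfolding val_event_def using J(1) by measurable
qed

lemma cond_prob_le_sup:
  assumes "finite S" "S \<subseteq> \<X>" "\<mu> \<in> valuations M X S" "prob (val_event M X S \<mu>) > 0"
  shows "\<P>(\<omega> in M. \<omega> \<in> A \<bar> \<omega> \<in> val_event M X S \<mu>) \<le> sup_cond_prob M X S A"
  unfolding sup_cond_prob_def
proof (rule cSUP_upper)
  show "bdd_above ((\<lambda>\<mu>. \<P>(\<omega> in M. \<omega> \<in> A \<bar> \<omega> \<in> val_event M X S \<mu>)) `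
          {\<mu> \<in> valuations M X S. measure M (val_event M X S \<mu>) > 0})"
  proof (intro bdd_aboveI2[of _ _ 1])
    fix \<mu>
    have "{\<omega>\<in>space M. \<omega> \<in> val_event M X S \<mu>} \<in> sets M"
      using val_event_sets[OF assms(1,2), of \<mu>] by simp
    then show "\<P>(\<omega> in M. \<omega> \<in> A \<bar> \<omega> \<in> val_event M X S \<mu>) \<le> 1"
      unfolding cond_prob_def by (intro divide_le_eq_1[THEN iffD2])
        (auto simp: zero_less_measure_iff less_le intro!: finite_measure_mono)
  qed
qed (use assms in auto)

lemma disjoint_val_events: "disjoint_family_on (val_event M X V) (valuations M X V)"
  unfolding disjoint_family_on_def
proof (intro ballI impI)
  fix \<rho> \<sigma> assume *: "\<rho> \<in> valuations M X V" "\<sigma> \<in> valuations M X V" "\<rho> \<noteq> \<sigma>"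
  then obtain x where "x \<in> V" "\<rho> x \<noteq> \<sigma> x"
    unfolding valuations_def by (metis PiE_ext)
  then show "val_event M X V \<rho> \<inter> val_event M X V \<sigma> = {}"
    by (auto simp: val_event_def)
qed

lemma finite_valuations: "finite V \<Longrightarrow> V \<subseteq> \<X> \<Longrightarrow> finite (valuations M X V)"
  unfolding valuations_def using finite_range by (intro finite_PiE) auto

text \<open>
  A step that resamples \<open>A\<close> is run backwards: the old values of \<open>rsp A\<close> are exchanged
  with the fresh ones, and what remains to be summed over the old values is the probability of
  \<open>A\<close> given the static variables.
\<close>

lemma sum_weight_predecessors_le:
  fixes Q :: real
  assumes A: "A \<in> \<A>" "vbl A \<subseteq> V" and V: "finite V" "V \<subseteq> \<X>"
    and \<rho>': "\<rho>' \<in> valuations M X V"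
    and Q: "sup_cond_prob M X (stc vbl rsp A) A \<le> Q"
  shows "(\<Sum>\<rho> | \<rho> \<in> valuations M X V \<and> (\<forall>x\<in>V - rsp A. \<rho> x = \<rho>' x) \<and> true_under X vbl \<rho> A.
            (\<Prod>x\<in>V. weight x (\<rho> x)) * (\<Prod>x\<in>rsp A. weight x (\<rho>' x)))
         \<le> Q * (\<Prod>x\<in>V. weight x (\<rho>' x))"
proof -
  define S where "S = stc vbl rsp A"
  define R where "R = {\<rho> \<in> valuations M X V. (\<forall>x\<in>V - rsp A. \<rho> x = \<rho>' x) \<and> true_under X vbl \<rho> A}"
  define q where "q \<rho> = (\<Prod>x\<in>rsp A. weight x (\<rho> x))" for \<rho>
  define s where "s = (\<Prod>x\<in>S. weight x (\<rho>' x))"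
  define e where "e = (\<Prod>x\<in>V - vbl A. weight x (\<rho>' x))"
  have vblA: "finite (vbl A)" "vbl A \<subseteq> \<X>" and rspA: "rsp A \<subseteq> vbl A"
    using A finite_vbl vbl_subset rsp_subset by auto
  have S: "finite S" "S \<subseteq> \<X>" "S \<subseteq> V" "S \<inter> rsp A = {}" "vbl A = S \<union> rsp A" and fin_rsp: "finite (rsp A)"
    using vblA rspA A finite_subset[OF rspA] by (auto simp: S_def stc_def)
  have split: "(\<Prod>x\<in>V. weight x (\<rho> x)) = (\<Prod>x\<in>V - vbl A. weight x (\<rho> x)) * ((\<Prod>x\<in>S. weight x (\<rho> x)) * q \<rho>)" for \<rho>
    unfolding q_def using S fin_rsp A V by (subst prod.subset_diff[of "vbl A"]) (auto simp: prod.union_disjoint)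
  have finR: "finite R"
    unfolding R_def using finite_valuations[OF V] by simp
  have R_prod: "(\<Prod>x\<in>V. weight x (\<rho> x)) = e * (s * q \<rho>)" if "\<rho> \<in> R" for \<rho>
  proof -
    have "(\<Prod>x\<in>V - vbl A. weight x (\<rho> x)) = e" "(\<Prod>x\<in>S. weight x (\<rho> x)) = s"
      unfolding e_def s_def using that S(3,4) rspA by (auto 0 3 simp: R_def intro!: prod.cong arg_cong2[where f = weight])
    then show ?thesis unfolding split by simp
  qed
  have e0: "0 \<le> e" and q0: "0 \<le> q \<rho>'"
    unfolding e_def q_def by (auto intro!: prod_nonneg weight_nonneg)
  have s0: "0 \<le> s"
    unfolding s_def by (auto intro!: prod_nonneg weight_nonneg)
  \<comment> \<open>\<open>s\<close> is the probability of the static values, and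
    \<open>s * sum q R\<close> is at most that of \<open>A\<close> together with them, so the
    conditional probability given these values enters. The case \<open>s = 0\<close>, where one
    cannot condition, is treated apart.\<close>
  have main: "s * sum q R \<le> Q * s"
  proof (cases "s = 0")
    case False
    define \<mu> where "\<mu> = restrict \<rho>' S"
    have \<mu>: "\<mu> \<in> valuations M X S"
      using \<rho>' S by (auto simp: \<mu>_def valuations_def PiE_iff)
    have s: "s = prob (val_event M X S \<mu>)"
      using S by (simp add: prob_val_event_eq s_def \<mu>_def)
    have "s * sum q R = (\<Sum>\<rho>\<in>R. prob (val_event M X (vbl A) \<rho>))"
      unfolding sum_distrib_left
    proof (rule sum.cong)
      fix \<rho> assume "\<rho> \<in> R"
      then have "(\<Prod>x\<in>S. weight x (\<rho> x)) = s"
        unfolding s_def using S(3,4) by (auto simp: R_def intro!: prod.cong arg_cong2[where f = weight])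
      then show "s * q \<rho> = prob (val_event M X (vbl A) \<rho>)"
        using S fin_rsp vblA by (simp add: prob_val_event_eq prod.union_disjoint q_def)
    qed simp
    also have "\<dots> = prob (\<Union>\<rho>\<in>R. val_event M X (vbl A) \<rho>)"
    proof (rule finite_measure_finite_Union[symmetric])
      \<comment> \<open>Members of \<open>R\<close> agree off \<open>rsp A\<close>, so distinct ones
        already differ on \<open>vbl A\<close>.\<close>
      show "disjoint_family_on (val_event M X (vbl A)) R"
        unfolding disjoint_family_on_def
      proof (intro ballI impI)
        fix \<rho> \<sigma> assume *: "\<rho> \<in> R" "\<sigma> \<in> R" "\<rho> \<noteq> \<sigma>"
        then obtain x where x: "x \<in> V" "\<rho> x \<noteq> \<sigma> x"
          unfolding R_def valuations_def by (metis (no_types, lifting) PiE_ext mem_Collect_eq)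
        then have "x \<in> rsp A"
          using *(1,2) by (cases "x \<in> rsp A") (simp_all add: R_def)
        with x(2) show "val_event M X (vbl A) \<rho> \<inter> val_event M X (vbl A) \<sigma> = {}"
          using rspA by (auto simp: val_event_def)
      qed
    qed (use finR vblA in \<open>auto intro!: val_event_sets\<close>)
    also have "\<dots> \<le> prob {\<omega>\<in>space M. \<omega> \<in> A \<and> \<omega> \<in> val_event M X S \<mu>}"
    proof (rule finite_measure_mono)
      show "{\<omega>\<in>space M. \<omega> \<in> A \<and> \<omega> \<in> val_event M X S \<mu>} \<in> sets M"
        using events_sets[OF A(1)] val_event_sets[OF S(1,2), of \<mu>] by auto
      have "val_event M X (vbl A) \<rho> \<subseteq> val_event M X S \<mu>" if "\<rho> \<in> R" for \<rho>
        using that S by (auto simp: R_def val_event_def \<mu>_def)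
      moreover have "val_event M X (vbl A) \<rho> \<subseteq> A" if "\<rho> \<in> R" for \<rho>
        using that val_event_subset_true[OF A(1)] by (simp add: R_def)
      ultimately show "(\<Union>\<rho>\<in>R. val_event M X (vbl A) \<rho>) \<subseteq> {\<omega>\<in>space M. \<omega> \<in> A \<and> \<omega> \<in> val_event M X S \<mu>}"
        using S val_event_sets[OF vblA, THEN sets.sets_into_space] by blast
    qed
    also have "\<dots> = \<P>(\<omega> in M. \<omega> \<in> A \<bar> \<omega> \<in> val_event M X S \<mu>) * s"
    proof -
      have "{\<omega>\<in>space M. \<omega> \<in> val_event M X S \<mu>} = val_event M X S \<mu>"
        by (auto simp: val_event_def)
      then show ?thesis using False by (simp add: cond_prob_def s)
    qed
    also have "\<dots> \<le> Q * s"
    proof (rule mult_right_mono)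
      have "0 < prob (val_event M X S \<mu>)" using False s by (simp add: zero_less_measure_iff)
      then show "\<P>(\<omega> in M. \<omega> \<in> A \<bar> \<omega> \<in> val_event M X S \<mu>) \<le> Q"
        using cond_prob_le_sup[OF S(1,2) \<mu>, of A] Q by (simp add: S_def)
    qed (rule s0)
    finally show ?thesis .
  qed simp
  \<comment> \<open>The fresh factor \<open>q \<rho>'\<close> completes the weight of
    \<open>\<rho>'\<close>, while the old factors \<open>q \<rho>\<close> are summed up by
    \<open>main\<close>.\<close>
  have "(\<Sum>\<rho>\<in>R. (\<Prod>x\<in>V. weight x (\<rho> x)) * q \<rho>') = (\<Sum>\<rho>\<in>R. e * s * q \<rho>' * q \<rho>)"
    by (intro sum.cong) (simp_all add: R_prod)
  also have "\<dots> = e * q \<rho>' * (s * sum q R)"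
    by (simp add: sum_distrib_left[symmetric])
  also have "\<dots> \<le> e * q \<rho>' * (Q * s)"
    using main e0 q0 by (intro mult_left_mono) auto
  also have "\<dots> = Q * (\<Prod>x\<in>V. weight x (\<rho>' x))"
    unfolding split[of \<rho>'] by (simp add: e_def s_def)
  finally show ?thesis
    unfolding R_def q_def by simp
qed

section \<open>Admissible words and their total weight\<close>

text \<open>At \<open>None\<close>, the start of a word, the condition is vacuous and every letter
  of \<open>C\<close> is allowed.\<close>

definition successors :: "'w set set \<Rightarrow> 'w set option \<Rightarrow> 'w set set" where
  "successors C l = {A\<in>C. \<forall>B. l = Some B \<longrightarrow> \<not> far_below \<A> rsp prec A B}"

text \<open>
  The total weight \<open>P A\<^sub>1 \<cdots> P A\<^sub>n\<close> of the admissible words of length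
  \<open>n\<close> over \<open>C\<close> with last letter \<open>l\<close>, where \<open>None\<close>
  stands for the missing last letter of the empty word.
\<close>

primrec log_bound :: "('w set \<Rightarrow> real) \<Rightarrow> 'w set set \<Rightarrow> nat \<Rightarrow> 'w set option \<Rightarrow> real" where
  "log_bound P C 0 l = (if l = None then 1 else 0)"
| "log_bound P C (Suc n) l = (case l of None \<Rightarrow> 0 | Some A \<Rightarrow>
     P A * (\<Sum>l' | l' \<in> insert None (Some ` C) \<and> A \<in> successors C l'. log_bound P C n l'))"

text \<open>Suppose the last letter is \<open>B\<close> and D \<ll> B. From A \<prec> D \<prec> B
  and the failure of A \<ll> B it follows that \<open>A\<close> and \<open>B\<close> are neighbours,
  whereas \<open>D\<close> and \<open>B\<close> are not. The condition linking order and
  neighbourhoods then puts \<open>B\<close> below \<open>D\<close>, a contradiction.\<close>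

lemma successors_upward_closed:
  assumes C: "C \<subseteq> \<A>" and l: "l \<in> insert None (Some ` C)"
    and A: "A \<in> successors C l" "D \<in> C" "pos A < pos D"
  shows "D \<in> successors C l"
proof (rule ccontr)
  assume "D \<notin> successors C l"
  then obtain B where B: "l = Some B" "far_below \<A> rsp prec D B" "B \<in> C"
    using A l by (auto simp: successors_def)
  have AD: "(A, D) \<in> prec" "A \<in> \<A>" "B \<in> \<A>" "D \<in> \<A>"
    using A B C by (auto simp: successors_def prec_iff_pos subset_iff)
  have DB: "(D, B) \<in> prec" "D \<notin> nbhd \<A> rsp B"
    using B by (auto simp: far_below_def)
  have "A \<in> nbhd \<A> rsp B"
    using A B prec_trans[OF AD(1) DB(1)] by (auto simp: successors_def far_below_def)
  then have "B \<in> nbhd_plus \<A> rsp A"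
    using AD by (auto simp: nbhd_plus_def nbhd_def)
  moreover have "B \<notin> nbhd_plus \<A> rsp D"
    using DB AD prec_irrefl by (auto simp: nbhd_plus_def nbhd_def)
  ultimately have "(B, D) \<in> prec"
    using prec_nbhd AD by blast
  then show False
    using DB prec_trans prec_irrefl by blast
qed

text \<open>The successors of \<open>A\<close> are \<open>A\<close> itself, the later events of
  \<open>C\<close> and the earlier neighbours of \<open>A\<close> in \<open>C\<close>. The factors
  of the last group cancel against the local condition, and z/(1-z) = 1/(1-z) - 1 accounts for
  \<open>A\<close>.\<close>

lemma local_condition_le:
  fixes P z :: "'w set \<Rightarrow> real"
  assumes C: "finite C" "C \<subseteq> \<A>" and A: "A \<in> C"
    and z: "\<And>A. A \<in> \<A> \<Longrightarrow> z A \<in> {0<..<1}"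
    and P: "P A \<le> z A * unordered_prod (\<lambda>B. 1 - z B) (nbhd \<A> rsp A)"
  shows "P A * (\<Prod>B\<in>successors C (Some A). 1 / (1 - z B)) \<le>
           (1 / (1 - z A) - 1) * (\<Prod>B | B \<in> C \<and> pos A < pos B. 1 / (1 - z B))"
proof -
  define F where "F = {B\<in>C. pos B < pos A \<and> B \<in> nbhd \<A> rsp A}"
  define U where "U = {B\<in>C. pos A < pos B}"
  define g where "g B = 1 / (1 - z B)" for B
  have finF: "finite F" "finite U" using C by (auto simp: F_def U_def)
  have zC: "0 < z B" "z B < 1" if "B \<in> C" for B using z[of B] that C by auto
  have "successors C (Some A) = insert A (F \<union> U)"
  proof -
    have "B \<in> successors C (Some A) \<longleftrightarrow> B \<in> insert A (F \<union> U)" if "B \<in> C" for B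
      using that A C inj_onD[OF inj_on_pos, of A B] prec_iff_pos[of B A]
      by (auto simp: successors_def F_def U_def far_below_def subset_iff)
    then show ?thesis using A by (auto simp: successors_def F_def U_def)
  qed
  moreover have "prod g (insert A (F \<union> U)) = g A * (prod g F * prod g U)"
    using finF by (subst prod.insert) (auto simp: F_def U_def intro!: prod.union_disjoint)
  ultimately have succ: "prod g (successors C (Some A)) = g A * (prod g F * prod g U)"
    by simp
  have g0: "0 \<le> g B" if "B \<in> C" for B using zC[OF that] by (simp add: g_def)
  have g0': "0 \<le> g A" "0 \<le> prod g F" "0 \<le> prod g U"
    using A by (auto intro!: prod_nonneg g0 simp: F_def U_def)
  have "unordered_prod (\<lambda>B. 1 - z B) (nbhd \<A> rsp A) \<le> (\<Prod>B\<in>F. 1 - z B)"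
    using z finF by (intro unordered_prod_le) (fastforce simp: nbhd_def F_def)+
  then have "P A \<le> z A * (\<Prod>B\<in>F. 1 - z B)"
    using P zC[OF A] by (meson mult_left_mono less_imp_le order_trans)
  then have "P A * prod g (successors C (Some A)) \<le>
      z A * (\<Prod>B\<in>F. 1 - z B) * prod g (successors C (Some A))"
    using g0' unfolding succ by (intro mult_right_mono) auto
  also have "\<dots> = z A * g A * ((\<Prod>B\<in>F. 1 - z B) * prod g F) * prod g U"
    unfolding succ by (simp add: mult_ac)
  also have "(\<Prod>B\<in>F. 1 - z B) * prod g F = 1"
    unfolding prod.distrib[symmetric] g_def using zC by (intro prod.neutral) (force simp: F_def)
  also have "z A * g A = g A - 1"
    using zC[OF A] by (simp add: g_def field_simps)
  finally show ?thesis by (simp add: g_def U_def)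
qed

lemma log_bound_nonneg:
  assumes "C \<subseteq> \<A>" "\<And>A. A \<in> \<A> \<Longrightarrow> 0 \<le> P A" "l \<in> insert None (Some ` C)"
  shows "0 \<le> log_bound P C n l"
  using assms(3)
  by (induction n arbitrary: l) (use assms(1,2) in \<open>auto simp: subset_iff intro!: mult_nonneg_nonneg sum_nonneg\<close>)

text \<open>A potential argument: each word is weighted by \<open>H\<close> at its last letter.
  Adding one letter lowers the potential \<open>\<Phi>\<close> by at least the total weight of the
  current words, so all these weights together are at most the initial potential, the product over
  \<open>C\<close>.\<close>

lemma sum_log_bound_le:
  fixes P z :: "'w set \<Rightarrow> real"
  assumes C: "finite C" "C \<subseteq> \<A>"
    and z: "\<And>A. A \<in> \<A> \<Longrightarrow> z A \<in> {0<..<1}"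
    and P0: "\<And>A. A \<in> \<A> \<Longrightarrow> 0 \<le> P A"
    and P: "\<And>A. A \<in> \<A> \<Longrightarrow> P A \<le> z A * unordered_prod (\<lambda>B. 1 - z B) (nbhd \<A> rsp A)"
  shows "(\<Sum>n<N. \<Sum>l\<in>insert None (Some ` C). log_bound P C n l) \<le> (\<Prod>A\<in>C. 1 / (1 - z A))"
proof -
  define L where "L = insert None (Some ` C)"
  define H where "H l = (\<Prod>B\<in>successors C l. 1 / (1 - z B))" for l
  have finL: "finite L" using C by (simp add: L_def)
  have c0: "0 \<le> log_bound P C n l" if "l \<in> L" for n l
    using that C(2) P0 by (intro log_bound_nonneg) (auto simp: L_def)
  have H0: "0 \<le> H l" for l
    unfolding H_def using z C by (intro prod_nonneg) (fastforce simp: successors_def)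
  have H_step: "(\<Sum>A\<in>successors C l. P A * H (Some A)) \<le> H l - 1" if l: "l \<in> L" for l
  proof -
    have sub: "successors C l \<subseteq> C" by (auto simp: successors_def)
    have "(\<Sum>A\<in>successors C l. P A * H (Some A)) \<le>
        (\<Sum>A\<in>successors C l. (1 / (1 - z A) - 1) * (\<Prod>B | B \<in> C \<and> pos A < pos B. 1 / (1 - z B)))"
      unfolding H_def using sub C z P by (intro sum_mono local_condition_le) auto
    \<comment> \<open>By upward closure, everything in \<open>C\<close> above a successor is again a
      successor, which brings the sum into telescoping form.\<close>
    also have "\<dots> = (\<Sum>A\<in>successors C l. (1 / (1 - z A) - 1) *
        (\<Prod>B\<in>{B\<in>successors C l. pos A < pos B}. 1 / (1 - z B)))"
      using sub successors_upward_closed[OF C(2) l[unfolded L_def]]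
      by (intro sum.cong arg_cong2[where f = "(*)"] prod.cong) auto
    also have "\<dots> = H l - 1"
      unfolding H_def using sub C inj_on_pos
      by (intro telescoping_upper_products) (auto intro: finite_subset inj_on_subset)
    finally show ?thesis .
  qed
  define \<Phi> where "\<Phi> n = (\<Sum>l\<in>L. log_bound P C n l * H l)" for n
  have \<Phi>0: "0 \<le> \<Phi> n" for n
    unfolding \<Phi>_def using c0 H0 by (intro sum_nonneg mult_nonneg_nonneg)
  have step: "\<Phi> (Suc n) \<le> \<Phi> n - (\<Sum>l\<in>L. log_bound P C n l)" for n
  proof -
    have "\<Phi> (Suc n) = (\<Sum>A\<in>C. log_bound P C (Suc n) (Some A) * H (Some A))"
      unfolding \<Phi>_def L_def using C by (simp add: sum.reindex image_iff del: log_bound.simps(2)) simp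
    also have "\<dots> = (\<Sum>A\<in>C. \<Sum>l | l \<in> L \<and> A \<in> successors C l. P A * log_bound P C n l * H (Some A))"
      by (simp add: sum_distrib_left sum_distrib_right L_def)
    \<comment> \<open>Regrouping by the letter that is being followed makes \<open>H_step\<close>
      applicable.\<close>
    also have "\<dots> = (\<Sum>l\<in>L. \<Sum>A | A \<in> C \<and> A \<in> successors C l. P A * log_bound P C n l * H (Some A))"
      by (rule sum.swap_restrict[OF C(1) finL])
    also have "\<dots> = (\<Sum>l\<in>L. log_bound P C n l * (\<Sum>A\<in>successors C l. P A * H (Some A)))"
      unfolding sum_distrib_left
      by (intro sum.cong) (auto simp: successors_def mult_ac)
    also have "\<dots> \<le> (\<Sum>l\<in>L. log_bound P C n l * (H l - 1))"
      using c0 H_step by (intro sum_mono mult_left_mono) auto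
    finally show ?thesis
      by (simp add: \<Phi>_def right_diff_distrib sum_subtractf)
  qed
  have "(\<Sum>n<N. \<Sum>l\<in>L. log_bound P C n l) \<le> \<Phi> 0 - \<Phi> N"
  proof (induction N)
    case (Suc N)
    then show ?case using step[of N] by simp
  qed simp
  also have "\<dots> \<le> \<Phi> 0" using \<Phi>0 by simp
  also have "\<Phi> 0 = (\<Prod>A\<in>C. 1 / (1 - z A))"
    using C by (simp add: \<Phi>_def L_def H_def successors_def sum.reindex)
  finally show ?thesis by (simp only: L_def)
qed

section \<open>Measurability and successive steps of the run\<close>

text \<open>Witnesses are traded for valuations of \<open>vbl A\<close>. For an event of
  \<open>\<A>\<close> only finitely many occur, so truth becomes a finite combination of measurable
  conditions.\<close>

lemma true_under_iff_valuation:
  "true_under X vbl \<rho> A \<longleftrightarrow> (\<exists>\<mu>\<in>(\<lambda>\<omega>. restrict (\<lambda>x. X x \<omega>) (vbl A)) ` A. \<forall>x\<in>vbl A. \<rho> x = \<mu> x)"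
  unfolding true_under_def by (simp add: eq_commute[of "\<rho> _"])

lemma pred_true_under:
  assumes A: "A \<in> \<A>" and f: "\<And>x. x \<in> \<X> \<Longrightarrow> (\<lambda>\<omega>. f \<omega> x) \<in> measurable K (count_space UNIV)"
  shows "Measurable.pred K (\<lambda>\<omega>. true_under X vbl (f \<omega>) A)"
proof -
  have "(\<lambda>\<omega>. restrict (\<lambda>x. X x \<omega>) (vbl A)) ` A \<subseteq> (\<Pi>\<^sub>E x\<in>vbl A. X x ` space M)"
    using sets.sets_into_space[OF events_sets[OF A]] by auto
  then have fin: "finite ((\<lambda>\<omega>. restrict (\<lambda>x. X x \<omega>) (vbl A)) ` A)"
    using finite_vbl[OF A] vbl_subset[OF A] finite_range
    by (elim finite_subset) (auto intro!: finite_PiE)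
  have "Measurable.pred K (\<lambda>\<omega>. f \<omega> x = v)" if "x \<in> vbl A" for x v
    using measurable_compose[OF f, of x "\<lambda>y. y = v" "count_space UNIV"] that vbl_subset[OF A]
    by auto
  then show ?thesis
    unfolding true_under_iff_valuation
    by (intro pred_intros_finite(4)[OF fin] pred_intros_finite(3)[OF finite_vbl[OF A]])
qed

lemma pred_least:
  assumes A: "A \<in> \<A>" and f: "\<And>x. x \<in> \<X> \<Longrightarrow> (\<lambda>\<omega>. f \<omega> x) \<in> measurable K (count_space UNIV)"
  shows "Measurable.pred K (\<lambda>\<omega>. least (f \<omega>) = Some A)"
proof -
  note [measurable] = pred_true_under[of _ f, OF _ f]
  have "Measurable.pred K (\<lambda>\<omega>. \<forall>B\<in>{B\<in>\<A>. (B, A) \<in> prec}. \<not> true_under X vbl (f \<omega>) B)"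
    by (rule pred_intros_finite(3)[OF prec_omega[OF A]]) simp
  then show ?thesis
    unfolding least_eq_Some_iff using A by simp
qed

text \<open>The update of a single variable becomes a countable disjunction over the events
  resampling it, in place of a case analysis on the selected event.\<close>

lemma run_Suc_apply:
  "run X \<A> vbl rsp prec s (Suc n) x =
     (if \<exists>A\<in>{A\<in>\<A>. x \<in> rsp A}. least (run X \<A> vbl rsp prec s n) = Some A
      then s (Suc n) x else run X \<A> vbl rsp prec s n x)"
proof (cases "least (run X \<A> vbl rsp prec s n)")
  case (Some A)
  then have "A \<in> \<A>" by (simp only: least_eq_Some_iff)
  with Some show ?thesis by simp
qed simp

text \<open>\<open>K\<close> is arbitrary and only samples up to stage \<open>n\<close> are assumed
  measurable, so that the lemma applies to \<open>N\<close> as well as to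
  \<open>past n\<close>.\<close>

lemma measurable_run:
  assumes "\<And>k x. k \<le> n \<Longrightarrow> x \<in> \<X> \<Longrightarrow> s k x \<in> measurable K (count_space UNIV)" "x \<in> \<X>"
  shows "(\<lambda>\<omega>. run X \<A> vbl rsp prec (\<lambda>k x. s k x \<omega>) n x) \<in> measurable K (count_space UNIV)"
  using assms
proof (induction n arbitrary: x)
  case (Suc n)
  have IH: "(\<lambda>\<omega>. run X \<A> vbl rsp prec (\<lambda>k x. s k x \<omega>) n y) \<in> measurable K (count_space UNIV)"
    if "y \<in> \<X>" for y
    using Suc that by simp
  have "(\<Union>A\<in>{A\<in>\<A>. x \<in> rsp A}. {\<omega>\<in>space K. least (run X \<A> vbl rsp prec (\<lambda>k x. s k x \<omega>) n) = Some A}) \<in> sets K"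
  proof (rule sets.countable_UN')
    show "countable {A\<in>\<A>. x \<in> rsp A}"
      by (rule countable_subset[OF _ countable_events]) auto
    show "(\<lambda>A. {\<omega>\<in>space K. least (run X \<A> vbl rsp prec (\<lambda>k x. s k x \<omega>) n) = Some A}) `
        {A\<in>\<A>. x \<in> rsp A} \<subseteq> sets K"
      using pred_least[of _ "\<lambda>\<omega>. run X \<A> vbl rsp prec (\<lambda>k x. s k x \<omega>) n" K, OF _ IH]
      by (auto simp: pred_def)
  qed
  also have "(\<Union>A\<in>{A\<in>\<A>. x \<in> rsp A}. {\<omega>\<in>space K. least (run X \<A> vbl rsp prec (\<lambda>k x. s k x \<omega>) n) = Some A}) =
      {\<omega>\<in>space K. \<exists>A\<in>{A\<in>\<A>. x \<in> rsp A}. least (run X \<A> vbl rsp prec (\<lambda>k x. s k x \<omega>) n) = Some A}"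
    by blast
  finally have "{\<omega>\<in>space K. \<exists>A\<in>{A\<in>\<A>. x \<in> rsp A}. least (run X \<A> vbl rsp prec (\<lambda>k x. s k x \<omega>) n) = Some A} \<in> sets K" .
  then show ?case
    unfolding run_Suc_apply using Suc.prems IH by (intro measurable_If) auto
qed simp

lemma sum_weight_le_1:
  assumes "finite V" "V \<subseteq> \<X>"
  shows "(\<Sum>\<rho>\<in>valuations M X V. \<Prod>x\<in>V. weight x (\<rho> x)) \<le> 1"
proof -
  have "(\<Sum>\<rho>\<in>valuations M X V. \<Prod>x\<in>V. weight x (\<rho> x)) = (\<Sum>\<rho>\<in>valuations M X V. prob (val_event M X V \<rho>))"
    using assms by (simp add: prob_val_event_eq)
  also have "\<dots> = prob (\<Union>\<rho>\<in>valuations M X V. val_event M X V \<rho>)"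
    using assms by (intro finite_measure_finite_Union[symmetric] finite_valuations disjoint_val_events)
      (auto intro!: val_event_sets)
  finally show ?thesis by simp
qed

text \<open>If A \<ll> B, resampling \<open>B\<close> touches no variable of \<open>A\<close>; so
  \<open>A\<close> was already true under \<open>\<rho>\<close> and, preceding \<open>B\<close>,
  would have barred the selection of \<open>B\<close>.\<close>

lemma not_far_below_next:
  assumes "least \<rho> = Some B" "least \<sigma> = Some A" "\<And>x. x \<notin> rsp B \<Longrightarrow> \<sigma> x = \<rho> x"
  shows "\<not> far_below \<A> rsp prec A B"
proof
  assume far: "far_below \<A> rsp prec A B"
  have A: "A \<in> \<A>" "true_under X vbl \<sigma> A" and B: "B \<in> \<A>"
    "\<And>D. D \<in> \<A> \<Longrightarrow> (D, B) \<in> prec \<Longrightarrow> \<not> true_under X vbl \<rho> D"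
    using assms(1,2) unfolding least_eq_Some_iff by auto
  have "rsp B \<inter> vbl A = {}"
    using far_disjoint A B far by simp
  then have "true_under X vbl \<rho> A"
    using A(2) assms(3) true_under_cong[of vbl A \<sigma> \<rho>] by blast
  then show False
    using B A far by (auto simp: far_below_def)
qed

end

section \<open>The table of samples and independence of the past\<close>

locale resample_process = resample_setting M X \<X> \<A> vbl rsp prec + N: prob_space N
  for M :: "'w measure" and X :: "'x \<Rightarrow> 'w \<Rightarrow> 'v" and \<X> \<A> vbl rsp prec
    and N :: "'u measure" +
  fixes T :: "nat \<Rightarrow> 'x \<Rightarrow> 'u \<Rightarrow> 'v"
  assumes samples: "independent_samples M X \<X> N T"
begin

abbreviation "R n \<omega> \<equiv> run X \<A> vbl rsp prec (\<lambda>k x. T k x \<omega>) n"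

lemma T_indep: "N.indep_vars (\<lambda>_. count_space UNIV) (\<lambda>(n, x). T n x) (UNIV \<times> \<X>)"
  and T_distr: "x \<in> \<X> \<Longrightarrow> distr N (count_space UNIV) (T n x) = distr M (count_space UNIV) (X x)"
  using samples by (auto simp: independent_samples_def)

lemma T_measurable: "x \<in> \<X> \<Longrightarrow> T n x \<in> measurable N (count_space UNIV)"
  using T_indep unfolding N.indep_vars_def by force

lemma X_measurable: "x \<in> \<X> \<Longrightarrow> X x \<in> measurable M (count_space UNIV)"
  using indep unfolding indep_vars_def by simp

lemma prob_T_eq: "x \<in> \<X> \<Longrightarrow> N.prob {\<omega>\<in>space N. T n x \<omega> = v} = weight x v"
proof -
  assume x: "x \<in> \<X>"
  have "N.prob (T n x -` {v} \<inter> space N) = prob (X x -` {v} \<inter> space M)"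
    using arg_cong[OF T_distr[OF x, of n], of "\<lambda>K. measure K {v}"]
    by (simp add: measure_distr T_measurable X_measurable x)
  moreover have "T n x -` {v} \<inter> space N = {\<omega>\<in>space N. T n x \<omega> = v}"
    "X x -` {v} \<inter> space M = {\<omega>\<in>space M. X x \<omega> = v}" by auto
  ultimately show ?thesis by (simp add: weight_def)
qed

lemma prob_samples:
  assumes J: "finite J" "J \<subseteq> \<X>"
  shows "N.prob {\<omega>\<in>space N. \<forall>x\<in>J. T n x \<omega> = v x} = (\<Prod>x\<in>J. weight x (v x))"
proof -
  have "{\<omega>\<in>space N. \<forall>x\<in>J. T n x \<omega> = v x} = val_event N (\<lambda>(n, x). T n x) (Pair n ` J) (\<lambda>(n, x). v x)"
    by (auto simp: val_event_def)
  also have "N.prob \<dots> = (\<Prod>p\<in>Pair n ` J. N.prob {\<omega>\<in>space N. (case p of (n, x) \<Rightarrow> T n x) \<omega> = (case p of (n, x) \<Rightarrow> v x)})"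
    using J by (intro N.prob_val_event[OF T_indep]) auto
  also have "\<dots> = (\<Prod>x\<in>J. weight x (v x))"
    using J by (subst prod.reindex) (auto simp: inj_on_def prob_T_eq subset_iff intro!: prod.cong)
  finally show ?thesis .
qed

text \<open>The body has the form that \<open>N.indep_var_restrict\<close> expects, so that blocks
  with disjoint index sets are independent.\<close>

definition block :: "(nat \<times> 'x) set \<Rightarrow> 'u \<Rightarrow> nat \<times> 'x \<Rightarrow> 'v" where
  "block B \<omega> = restrict (\<lambda>p. (case p of (k, x) \<Rightarrow> T k x) \<omega>) B"

abbreviation block_space :: "(nat \<times> 'x) set \<Rightarrow> (nat \<times> 'x \<Rightarrow> 'v) measure" where
  "block_space B \<equiv> PiM B (\<lambda>_. count_space UNIV)"

lemma block_apply: "(k, x) \<in> B \<Longrightarrow> block B \<omega> (k, x) = T k x \<omega>"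
  by (simp add: block_def)

lemma block_in_space: "block B \<omega> \<in> space (block_space B)"
  by (simp add: block_def space_PiM)

text \<open>The sigma-algebra generated by all samples of stages 0 to \<open>n\<close>, including
  those that the algorithm discards.\<close>

definition past :: "nat \<Rightarrow> 'u measure" where
  "past n = vimage_algebra (space N) (block ({..n} \<times> \<X>)) (block_space ({..n} \<times> \<X>))"

lemma space_past [simp]: "space (past n) = space N"
  by (simp add: past_def)

lemma T_measurable_past: "k \<le> n \<Longrightarrow> x \<in> \<X> \<Longrightarrow> T k x \<in> measurable (past n) (count_space UNIV)"
proof -
  assume k: "k \<le> n" "x \<in> \<X>"
  have "(\<lambda>\<omega>. block ({..n} \<times> \<X>) \<omega> (k, x)) \<in> measurable (past n) (count_space UNIV)"
    unfolding past_def
    by (rule measurable_compose[OF measurable_vimage_algebra1 measurable_component_singleton])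
      (use k block_in_space in auto)
  then show ?thesis using k by (simp add: block_apply)
qed

text \<open>\<open>G\<close> is a preimage under the block of stages up to \<open>n\<close>, and the
  condition on the samples is one under a block of stage n + 1. These blocks are disjoint, hence
  independent.\<close>

lemma prob_past_Int_samples:
  assumes G: "G \<in> sets (past n)" and J: "finite J" "J \<subseteq> \<X>"
  shows "N.prob (G \<inter> {\<omega>\<in>space N. \<forall>x\<in>J. T (Suc n) x \<omega> = v x}) = N.prob G * (\<Prod>x\<in>J. weight x (v x))"
proof -
  have "sets (past n) = {block ({..n} \<times> \<X>) -` Q \<inter> space N | Q. Q \<in> sets (block_space ({..n} \<times> \<X>))}"
    unfolding past_def using block_in_space by (intro sets_vimage_algebra2) auto
  then obtain Q where Q: "Q \<in> sets (block_space ({..n} \<times> \<X>))" "G = block ({..n} \<times> \<X>) -` Q \<inter> space N"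
    using G by auto
  define D where "D = {h\<in>space (block_space ({Suc n} \<times> J)). \<forall>x\<in>J. h (Suc n, x) = v x}"
  have "Measurable.pred (block_space ({Suc n} \<times> J)) (\<lambda>h. h (Suc n, x) = v x)" if "x \<in> J" for x
    by (rule measurable_compose[OF measurable_component_singleton]) (use that in auto)
  then have "Measurable.pred (block_space ({Suc n} \<times> J)) (\<lambda>h. \<forall>x\<in>J. h (Suc n, x) = v x)"
    by (rule pred_intros_finite(3)[OF J(1)])
  then have D: "D \<in> sets (block_space ({Suc n} \<times> J))"
    unfolding D_def pred_def .
  have D_eq: "block ({Suc n} \<times> J) -` D \<inter> space N = {\<omega>\<in>space N. \<forall>x\<in>J. T (Suc n) x \<omega> = v x}"
    using block_in_space by (auto simp: D_def block_apply)
  have "N.indep_var (block_space ({..n} \<times> \<X>)) (block ({..n} \<times> \<X>))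
      (block_space ({Suc n} \<times> J)) (block ({Suc n} \<times> J))"
    unfolding block_def[abs_def] using J by (intro N.indep_var_restrict[OF T_indep]) auto
  from N.indep_varD[OF this Q(1) D]
  have "N.prob ((\<lambda>\<omega>. (block ({..n} \<times> \<X>) \<omega>, block ({Suc n} \<times> J) \<omega>)) -` (Q \<times> D) \<inter> space N) =
      N.prob G * N.prob {\<omega>\<in>space N. \<forall>x\<in>J. T (Suc n) x \<omega> = v x}"
    unfolding Q(2) D_eq .
  moreover have "(\<lambda>\<omega>. (block ({..n} \<times> \<X>) \<omega>, block ({Suc n} \<times> J) \<omega>)) -` (Q \<times> D) \<inter> space N =
      G \<inter> {\<omega>\<in>space N. \<forall>x\<in>J. T (Suc n) x \<omega> = v x}"
    unfolding Q(2) D_eq[symmetric] by auto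
  ultimately show ?thesis using prob_samples[OF J] by simp
qed

lemma R_measurable: "x \<in> \<X> \<Longrightarrow> (\<lambda>\<omega>. R n \<omega> x) \<in> measurable N (count_space UNIV)"
  by (intro measurable_run T_measurable)

section \<open>The probability of a log\<close>

text \<open>The n-th log entry is selected under the valuation of stage n - 1, hence the shift.
  \<open>None\<close> is the empty log at stage 0; later it would mean halting, which
  \<open>log_state\<close> excludes.\<close>

definition last_event :: "nat \<Rightarrow> 'u \<Rightarrow> 'w set option" where
  "last_event n \<omega> = (case n of 0 \<Rightarrow> None | Suc m \<Rightarrow> least (R m \<omega>))"

text \<open>Only the last letter is recorded, since admissibility of the next one depends on nothing
  else; earlier letters are merely confined to \<open>C\<close>.\<close>

definition log_state :: "'w set set \<Rightarrow> 'x set \<Rightarrow> nat \<Rightarrow> 'w set option \<Rightarrow> ('x \<Rightarrow> 'v) \<Rightarrow> 'u set" where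
  "log_state C V n l \<rho> = {\<omega>\<in>space N. (\<forall>k\<in>{..<n}. \<exists>A\<in>C. least (R k \<omega>) = Some A) \<and>
     last_event n \<omega> = l \<and> (\<forall>x\<in>V. R n \<omega> x = \<rho> x)}"

lemma log_state_sets:
  assumes C: "finite C" "C \<subseteq> \<A>" and V: "finite V" "V \<subseteq> \<X>" and l: "l \<in> insert None (Some ` C)"
    and K: "space K = space N" "\<And>k x. k \<le> n \<Longrightarrow> x \<in> \<X> \<Longrightarrow> T k x \<in> measurable K (count_space UNIV)"
  shows "log_state C V n l \<rho> \<in> sets K"
proof -
  have R: "(\<lambda>\<omega>. R k \<omega> x) \<in> measurable K (count_space UNIV)" if "k \<le> n" "x \<in> \<X>" for k x
    using that K(2) by (intro measurable_run) auto
  have least: "Measurable.pred K (\<lambda>\<omega>. least (R k \<omega>) = Some A)" if "k \<le> n" "A \<in> C" for k A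
    using that C R by (intro pred_least) auto
  show ?thesis
  proof (cases "n = 0 \<or> l \<noteq> None")
    case True
    have "Measurable.pred K (\<lambda>\<omega>. \<forall>k\<in>{..<n}. \<exists>A\<in>C. least (R k \<omega>) = Some A)"
      using C least by (intro pred_intros_finite(3) pred_intros_finite(4)) auto
    moreover have "Measurable.pred K (\<lambda>\<omega>. last_event n \<omega> = l)"
      using True l least by (cases n) (auto simp: last_event_def)
    moreover have "Measurable.pred K (\<lambda>\<omega>. \<forall>x\<in>V. R n \<omega> x = \<rho> x)"
      using V R by (intro pred_intros_finite(3) measurable_compose[OF R]) auto
    ultimately have "Measurable.pred K (\<lambda>\<omega>. (\<forall>k\<in>{..<n}. \<exists>A\<in>C. least (R k \<omega>) = Some A) \<and>
       last_event n \<omega> = l \<and> (\<forall>x\<in>V. R n \<omega> x = \<rho> x))"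
      by (intro pred_intros_logic)
    then show ?thesis by (simp add: log_state_def pred_def K(1))
  next
    \<comment> \<open>If all earlier stages selected an event, a positive stage cannot have
      \<open>None\<close> as its last entry, so the set is empty.\<close>
    case False
    then obtain m where "n = Suc m" by (cases n) auto
    then have "log_state C V n l \<rho> = {}"
      using False by (force simp: log_state_def last_event_def)
    then show ?thesis by simp
  qed
qed

text \<open>When resampling \<open>A\<close> leads to \<open>\<rho>'\<close>, the fresh samples
  agree with \<open>\<rho>'\<close> on \<open>rsp A\<close>, and the previous valuation made
  \<open>A\<close> true and agreed with \<open>\<rho>'\<close> on the rest of \<open>V\<close>. The
  union runs over its unknown values and the letter before \<open>A\<close>.\<close>

lemma log_state_Suc_subset:
  assumes C: "C \<subseteq> \<A>" and V: "\<And>A. A \<in> C \<Longrightarrow> vbl A \<subseteq> V" and \<rho>': "\<rho>' \<in> valuations M X V" and A: "A \<in> C"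
  shows "log_state C V (Suc n) (Some A) \<rho>' \<subseteq>
    (\<Union>(\<rho>, l)\<in>{\<rho> \<in> valuations M X V. (\<forall>x\<in>V - rsp A. \<rho> x = \<rho>' x) \<and> true_under X vbl \<rho> A} \<times>
        {l. l \<in> insert None (Some ` C) \<and> A \<in> successors C l}.
      log_state C V n l \<rho> \<inter> {\<omega>\<in>space N. \<forall>x\<in>rsp A. T (Suc n) x \<omega> = \<rho>' x})"
proof
  fix \<omega> assume "\<omega> \<in> log_state C V (Suc n) (Some A) \<rho>'"
  then have \<omega>: "\<omega> \<in> space N" "\<And>k. k < Suc n \<Longrightarrow> \<exists>B\<in>C. least (R k \<omega>) = Some B"
    and least: "least (R n \<omega>) = Some A" and \<rho>'_eq: "\<And>x. x \<in> V \<Longrightarrow> R (Suc n) \<omega> x = \<rho>' x"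
    by (auto simp: log_state_def last_event_def)
  have A\<A>: "A \<in> \<A>" and true: "true_under X vbl (R n \<omega>) A"
    using least unfolding least_eq_Some_iff by auto
  have rspV: "rsp A \<subseteq> vbl A" "vbl A \<subseteq> V" using rsp_subset A\<A> V A by auto
  define \<rho> where "\<rho> = restrict (R n \<omega>) V"
  have off: "R n \<omega> x = \<rho>' x" if "x \<in> V - rsp A" for x
    using \<rho>'_eq[of x] that least by simp
  have on: "T (Suc n) x \<omega> = \<rho>' x" if "x \<in> rsp A" for x
    using \<rho>'_eq[of x] that least rspV by auto
  \<comment> \<open>Off \<open>rsp A\<close> the values are those of \<open>\<rho>'\<close>; on
    \<open>rsp A\<close> they lie in the ranges because the true event \<open>A\<close> has a
    witness.\<close>
  have "\<rho> \<in> valuations M X V"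
  proof -
    have "R n \<omega> x \<in> X x ` space M" if "x \<in> V" for x
    proof (cases "x \<in> rsp A")
      case True
      then show ?thesis using true_under_range[OF A\<A> true] rspV by auto
    next
      case False
      then show ?thesis using off[of x] \<rho>' that by (auto simp: valuations_def PiE_iff)
    qed
    then show ?thesis by (auto simp: \<rho>_def valuations_def)
  qed
  moreover have "true_under X vbl \<rho> A \<longleftrightarrow> true_under X vbl (R n \<omega>) A"
    by (rule true_under_cong) (use rspV in \<open>auto simp: \<rho>_def\<close>)
  moreover have "last_event n \<omega> \<in> insert None (Some ` C)"
  proof (cases n)
    case (Suc m)
    then show ?thesis using \<omega>(2)[of m] by (auto simp: last_event_def)
  qed (simp add: last_event_def)
  moreover have "A \<in> successors C (last_event n \<omega>)"
  proof (cases n)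
    case (Suc m)
    have "\<not> far_below \<A> rsp prec A B" if "least (R m \<omega>) = Some B" for B
      by (rule not_far_below_next[OF that least]) (simp add: Suc that)
    then show ?thesis using Suc A by (simp add: last_event_def successors_def)
  qed (use A in \<open>simp add: last_event_def successors_def\<close>)
  moreover have "\<omega> \<in> log_state C V n (last_event n \<omega>) \<rho>"
    using \<omega> by (simp add: log_state_def \<rho>_def)
  ultimately show "\<omega> \<in> (\<Union>(\<rho>, l)\<in>{\<rho> \<in> valuations M X V. (\<forall>x\<in>V - rsp A. \<rho> x = \<rho>' x) \<and> true_under X vbl \<rho> A} \<times>
        {l. l \<in> insert None (Some ` C) \<and> A \<in> successors C l}.
      log_state C V n l \<rho> \<inter> {\<omega>\<in>space N. \<forall>x\<in>rsp A. T (Suc n) x \<omega> = \<rho>' x})"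
    using true off on \<omega>(1) by (intro UN_I[of "(\<rho>, last_event n \<omega>)"]) (auto simp: \<rho>_def)
qed

text \<open>Keeping the weight of the valuation as a factor makes the bound inductive: the fresh
  samples contribute their weight by independence, and \<open>sum_weight_predecessors_le\<close>
  turns the sum over the old values into \<open>P A\<close> times the new weight.\<close>

lemma prob_log_state_le:
  fixes P :: "'w set \<Rightarrow> real"
  assumes C: "finite C" "C \<subseteq> \<A>" and V: "finite V" "V \<subseteq> \<X>" "\<And>A. A \<in> C \<Longrightarrow> vbl A \<subseteq> V"
    and P0: "\<And>A. A \<in> \<A> \<Longrightarrow> 0 \<le> P A"
    and P: "\<And>A. A \<in> \<A> \<Longrightarrow> sup_cond_prob M X (stc vbl rsp A) A \<le> P A"
    and "l \<in> insert None (Some ` C)" "\<rho> \<in> valuations M X V"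
  shows "N.prob (log_state C V n l \<rho>) \<le> log_bound P C n l * (\<Prod>x\<in>V. weight x (\<rho> x))"
  using assms(8-)
proof (induction n arbitrary: l \<rho>)
  case 0
  show ?case
  proof (cases "l = None")
    case True
    then have "log_state C V 0 l \<rho> = {\<omega>\<in>space N. \<forall>x\<in>V. T 0 x \<omega> = \<rho> x}"
      by (simp add: log_state_def last_event_def)
    then show ?thesis using True prob_samples[OF V(1,2), of 0 \<rho>] by simp
  next
    case False
    then have "log_state C V 0 l \<rho> = {}"
      by (auto simp: log_state_def last_event_def)
    then show ?thesis using False by auto
  qed
next
  case (Suc n l \<rho>')
  show ?case
  proof (cases l)
    case None
    then have "log_state C V (Suc n) l \<rho>' = {}"
      by (force simp: log_state_def last_event_def)
    then show ?thesis using None by simp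
  next
    case (Some A)
    then have A: "A \<in> C" "A \<in> \<A>" using Suc.prems C by auto
    define Z where "Z = {\<rho> \<in> valuations M X V. (\<forall>x\<in>V - rsp A. \<rho> x = \<rho>' x) \<and> true_under X vbl \<rho> A}"
    define L where "L = {l. l \<in> insert None (Some ` C) \<and> A \<in> successors C l}"
    define G where "G = {\<omega>\<in>space N. \<forall>x\<in>rsp A. T (Suc n) x \<omega> = \<rho>' x}"
    define w where "w \<rho> = (\<Prod>x\<in>V. weight x (\<rho> x))" for \<rho>
    define c where "c = (\<Prod>x\<in>rsp A. weight x (\<rho>' x))"
    have finZ: "finite Z"
      unfolding Z_def using finite_valuations[OF V(1,2)] by simp
    have finL: "finite L"
      unfolding L_def using C by simp
    have c0: "0 \<le> c" unfolding c_def by (intro prod_nonneg) (simp add: weight_nonneg)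
    have rspA: "finite (rsp A)" "rsp A \<subseteq> \<X>"
      using A rsp_subset[of A] finite_vbl[of A] vbl_subset[of A] by (auto intro: finite_subset)
    have G: "G \<in> sets N"
    proof -
      have "Measurable.pred N (\<lambda>\<omega>. \<forall>x\<in>rsp A. T (Suc n) x \<omega> = \<rho>' x)"
        using rspA by (intro pred_intros_finite(3) measurable_compose[OF T_measurable]) auto
      then show ?thesis unfolding G_def pred_def .
    qed
    have "N.prob (log_state C V (Suc n) l \<rho>') \<le> N.prob (\<Union>(\<rho>, l)\<in>Z \<times> L. log_state C V n l \<rho> \<inter> G)"
    proof (rule N.finite_measure_mono)
      show "(\<Union>(\<rho>, l)\<in>Z \<times> L. log_state C V n l \<rho> \<inter> G) \<in> sets N"
        using finZ finL G C V T_measurable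
        by (intro sets.finite_UN) (auto simp: L_def intro!: log_state_sets)
    qed (use log_state_Suc_subset[OF C(2) V(3) Suc.prems(2) A(1)] in \<open>auto simp: Some Z_def L_def G_def\<close>)
    also have "\<dots> \<le> (\<Sum>(\<rho>, l)\<in>Z \<times> L. N.prob (log_state C V n l \<rho> \<inter> G))"
    proof -
      have "N.prob (\<Union>p\<in>Z \<times> L. case p of (\<rho>, l) \<Rightarrow> log_state C V n l \<rho> \<inter> G) \<le>
          (\<Sum>p\<in>Z \<times> L. N.prob (case p of (\<rho>, l) \<Rightarrow> log_state C V n l \<rho> \<inter> G))"
        using finZ finL G C V T_measurable
        by (intro N.finite_measure_subadditive_finite) (auto simp: L_def intro!: log_state_sets)
      then show ?thesis by (simp add: case_prod_unfold)
    qed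
    also have "\<dots> \<le> (\<Sum>(\<rho>, l)\<in>Z \<times> L. log_bound P C n l * (w \<rho> * c))"
    proof (intro sum_mono, clarify)
      fix \<rho> l assume "\<rho> \<in> Z" "l \<in> L"
      then have *: "\<rho> \<in> valuations M X V" "l \<in> insert None (Some ` C)"
        by (auto simp: Z_def L_def)
      \<comment> \<open>The state at stage \<open>n\<close> is a function of the samples so far,
        which makes it independent of those of stage n + 1.\<close>
      have "log_state C V n l \<rho> \<in> sets (past n)"
        using C V * by (intro log_state_sets) (auto intro: T_measurable_past)
      then have "N.prob (log_state C V n l \<rho> \<inter> G) = N.prob (log_state C V n l \<rho>) * c"
        unfolding G_def c_def using prob_past_Int_samples rspA by blast
      also have "\<dots> \<le> log_bound P C n l * w \<rho> * c"
        unfolding w_def using Suc.IH[OF *(2,1)] c0 by (rule mult_right_mono)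
      finally show "N.prob (log_state C V n l \<rho> \<inter> G) \<le> log_bound P C n l * (w \<rho> * c)"
        by (simp add: mult.assoc)
    qed
    also have "\<dots> = (\<Sum>l\<in>L. log_bound P C n l) * (\<Sum>\<rho>\<in>Z. w \<rho> * c)"
      by (simp add: sum.cartesian_product[symmetric] sum_product sum.swap[of _ Z])
    also have "\<dots> \<le> (\<Sum>l\<in>L. log_bound P C n l) * (P A * w \<rho>')"
    proof (rule mult_left_mono)
      show "(\<Sum>\<rho>\<in>Z. w \<rho> * c) \<le> P A * w \<rho>'"
        unfolding Z_def w_def c_def
        by (rule sum_weight_predecessors_le[OF A(2) V(3)[OF A(1)] V(1,2) Suc.prems(2) P[OF A(2)]])
      show "0 \<le> (\<Sum>l\<in>L. log_bound P C n l)"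
        using C(2) P0 by (intro sum_nonneg log_bound_nonneg) (auto simp: L_def)
    qed
    also have "\<dots> = log_bound P C (Suc n) l * w \<rho>'"
      by (simp add: Some L_def)
    finally show ?thesis by (simp add: w_def)
  qed
qed

text \<open>\<open>T\<close> shares only its distributions with \<open>X\<close>, so samples may
  leave the ranges on a null set; countably many stages and variables allow a common one.\<close>

lemma AE_R_in_range: "AE \<omega> in N. \<forall>n. \<forall>x\<in>\<X>. R n \<omega> x \<in> X x ` space M"
proof -
  have "AE \<omega> in N. T n x \<omega> \<in> X x ` space M" if x: "x \<in> \<X>" for n x
  proof -
    have "AE y in distr M (count_space UNIV) (X x). y \<in> X x ` space M"
      using X_measurable[OF x] by (subst AE_distr_iff) auto
    then have "AE y in distr N (count_space UNIV) (T n x). y \<in> X x ` space M"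
      unfolding T_distr[OF x] .
    then show ?thesis
      using T_measurable[OF x] by (subst (asm) AE_distr_iff) auto
  qed
  then have "AE \<omega> in N. \<forall>n. \<forall>x\<in>\<X>. T n x \<omega> \<in> X x ` space M"
    using countable_vars by (simp add: AE_all_countable AE_ball_countable)
  then show ?thesis
  proof eventually_elim
    case (elim \<omega>)
    have "R n \<omega> x \<in> X x ` space M" if "x \<in> \<X>" for n x
      using that elim by (induction n) (auto split: option.split)
    then show ?case by blast
  qed
qed

end

section \<open>The stopping time\<close>

text \<open>An infimum, possibly over the empty set, becomes a condition on finitely many
  stages.\<close>

lemma less_stop_time_iff:
  "enat n < stop_time X \<A> vbl rsp prec \<B> s \<longleftrightarrow>
     (\<forall>k\<in>{..n}. \<exists>B\<in>\<B>. true_under X vbl (run X \<A> vbl rsp prec s k) B)"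
proof
  assume *: "enat n < stop_time X \<A> vbl rsp prec \<B> s"
  show "\<forall>k\<in>{..n}. \<exists>B\<in>\<B>. true_under X vbl (run X \<A> vbl rsp prec s k) B"
  proof (rule ccontr)
    assume "\<not> ?thesis"
    then obtain k where "k \<le> n" "\<forall>B\<in>\<B>. \<not> true_under X vbl (run X \<A> vbl rsp prec s k) B"
      by auto
    then have "stop_time X \<A> vbl rsp prec \<B> s \<le> enat n"
      unfolding stop_time_def by (intro INF_lower2[of k]) auto
    with * show False by simp
  qed
next
  assume *: "\<forall>k\<in>{..n}. \<exists>B\<in>\<B>. true_under X vbl (run X \<A> vbl rsp prec s k) B"
  have "enat (Suc n) \<le> stop_time X \<A> vbl rsp prec \<B> s"
    unfolding stop_time_def using * by (intro INF_greatest) (force simp: not_less_eq_eq)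
  then show "enat n < stop_time X \<A> vbl rsp prec \<B> s"
    by (simp add: Suc_ile_eq)
qed

context resample_process
begin

lemma stop_time_measurable:
  assumes B: "finite \<B>" "\<B> \<subseteq> \<A>"
  shows "(\<lambda>\<omega>. stop_time X \<A> vbl rsp prec \<B> (\<lambda>n x. T n x \<omega>)) \<in> measurable N (count_space UNIV)"
    (is "?t \<in> _")
proof -
  have [measurable]: "Measurable.pred N (\<lambda>\<omega>. enat n < ?t \<omega>)" for n
    unfolding less_stop_time_iff using B
    by (intro pred_intros_finite(3) pred_intros_finite(4) pred_true_under R_measurable) auto
  \<comment> \<open>The type \<open>enat\<close> is countable, so fibres suffice; each is a
    countable combination of tail events.\<close>
  have eq_enat: "a = enat k \<longleftrightarrow> (\<forall>i\<in>{..<k}. enat i < a) \<and> \<not> enat k < a" for a k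
  proof (cases a)
    case (enat m)
    have "m = k \<longleftrightarrow> (\<forall>i<k. i < m) \<and> \<not> k < m"
      using nat_neq_iff by blast
    then show ?thesis using enat by auto
  qed auto
  have eq_infinity: "a = \<infinity> \<longleftrightarrow> (\<forall>i. enat i < a)" for a
    by (cases a) auto
  have "Measurable.pred N (\<lambda>\<omega>. ?t \<omega> = a)" for a
  proof (cases a)
    case (enat k)
    show ?thesis
      unfolding enat eq_enat by measurable
  next
    case infinity
    show ?thesis
      unfolding infinity eq_infinity by measurable
  qed
  then have "{\<omega>\<in>space N. ?t \<omega> = a} \<in> sets N" for a
    by (simp add: pred_def)
  moreover have "?t -` {a} \<inter> space N = {\<omega>\<in>space N. ?t \<omega> = a}" for a by auto
  ultimately show ?thesis
    by (simp add: measurable_count_space_eq2_countable)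
qed

text \<open>While a member of \<open>\<B>\<close> is true, the selected event cannot come after it.
  This confines the log before the stopping time to \<open>C\<close>.\<close>

lemma least_in_lower_set:
  assumes "\<B> \<subseteq> \<A>" "\<exists>B\<in>\<B>. true_under X vbl \<rho> B"
  shows "\<exists>A\<in>\<B> \<union> (\<Union>B\<in>\<B>. {A\<in>\<A>. (A, B) \<in> prec}). least \<rho> = Some A"
proof -
  obtain B where B: "B \<in> \<B>" "B \<in> \<A>" "true_under X vbl \<rho> B"
    using assms by auto
  then obtain A where A: "least \<rho> = Some A"
    using least_eq_None_iff[of \<rho>] by (cases "least \<rho>") auto
  then have "A \<in> \<A>" "(B, A) \<notin> prec"
    using B unfolding least_eq_Some_iff by auto
  then have "A = B \<or> (A, B) \<in> prec"
    using B prec_total by blast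
  then show ?thesis using A B \<open>A \<in> \<A>\<close> by auto
qed

text \<open>Up to a null set, running beyond stage \<open>n\<close> means being in some state
  \<open>log_state C V n l \<rho>\<close>. A union bound applies, and the weights of the valuations
  add up to at most 1.\<close>

lemma prob_running_le:
  fixes P :: "'w set \<Rightarrow> real"
  assumes B: "finite \<B>" "\<B> \<subseteq> \<A>"
    and P0: "\<And>A. A \<in> \<A> \<Longrightarrow> 0 \<le> P A"
    and P: "\<And>A. A \<in> \<A> \<Longrightarrow> sup_cond_prob M X (stc vbl rsp A) A \<le> P A"
    and C: "C = \<B> \<union> (\<Union>B\<in>\<B>. {A\<in>\<A>. (A, B) \<in> prec})"
  shows "emeasure N {\<omega>\<in>space N. enat n < stop_time X \<A> vbl rsp prec \<B> (\<lambda>n x. T n x \<omega>)} \<le>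
           ennreal (\<Sum>l\<in>insert None (Some ` C). log_bound P C n l)"
proof -
  define V where "V = (\<Union>A\<in>C. vbl A)"
  define L where "L = insert None (Some ` C)"
  have finC: "finite C" and CA: "C \<subseteq> \<A>"
    unfolding C using B prec_omega by auto
  have V: "finite V" "V \<subseteq> \<X>" "\<And>A. A \<in> C \<Longrightarrow> vbl A \<subseteq> V"
    unfolding V_def using finC CA finite_vbl vbl_subset by auto
  have fin: "finite (valuations M X V)" "finite L"
    using finite_valuations[OF V(1,2)] finC by (auto simp: L_def)
  define U where "U = (\<Union>p\<in>valuations M X V \<times> L. log_state C V n (snd p) (fst p))"
  have sets: "log_state C V n l \<rho> \<in> sets N" if "l \<in> L" for l \<rho>
    using finC CA V that T_measurable by (intro log_state_sets) (auto simp: L_def)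
  have U: "U \<in> sets N"
    unfolding U_def using fin sets by (intro sets.finite_UN) auto
  have "emeasure N {\<omega>\<in>space N. enat n < stop_time X \<A> vbl rsp prec \<B> (\<lambda>n x. T n x \<omega>)} \<le> emeasure N U"
  proof (rule emeasure_mono_AE[OF _ U])
    show "AE \<omega> in N. \<omega> \<in> {\<omega>\<in>space N. enat n < stop_time X \<A> vbl rsp prec \<B> (\<lambda>n x. T n x \<omega>)} \<longrightarrow> \<omega> \<in> U"
      using AE_R_in_range
    proof eventually_elim
      case (elim \<omega>)
      show ?case
      proof
        assume *: "\<omega> \<in> {\<omega>\<in>space N. enat n < stop_time X \<A> vbl rsp prec \<B> (\<lambda>n x. T n x \<omega>)}"
        then have least: "\<exists>A\<in>C. least (R k \<omega>) = Some A" if "k \<le> n" for k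
          using that least_in_lower_set[OF B(2), of "R k \<omega>"] unfolding C by (auto simp: less_stop_time_iff)
        have "last_event n \<omega> \<in> L"
        proof (cases n)
          case (Suc m)
          then show ?thesis using least[of m] by (auto simp: last_event_def L_def)
        qed (simp add: last_event_def L_def)
        moreover have "restrict (R n \<omega>) V \<in> valuations M X V"
          using elim V(2) by (auto simp: valuations_def)
        moreover have "\<omega> \<in> log_state C V n (last_event n \<omega>) (restrict (R n \<omega>) V)"
          using * least by (simp add: log_state_def)
        ultimately show "\<omega> \<in> U"
          unfolding U_def by (intro UN_I[of "(restrict (R n \<omega>) V, last_event n \<omega>)"]) auto
      qed
    qed
  qed
  also have "\<dots> = ennreal (N.prob U)"
    by (rule N.emeasure_eq_measure)
  also have "N.prob U \<le> (\<Sum>p\<in>valuations M X V \<times> L. N.prob (log_state C V n (snd p) (fst p)))"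
    unfolding U_def using fin sets by (intro N.finite_measure_subadditive_finite) auto
  also have "\<dots> \<le> (\<Sum>p\<in>valuations M X V \<times> L. log_bound P C n (snd p) * (\<Prod>x\<in>V. weight x (fst p x)))"
    using P0 P by (intro sum_mono prob_log_state_le finC CA V) (auto simp: L_def)
  also have "\<dots> = (\<Sum>\<rho>\<in>valuations M X V. \<Prod>x\<in>V. weight x (\<rho> x)) * (\<Sum>l\<in>L. log_bound P C n l)"
    unfolding sum_product sum.cartesian_product case_prod_unfold by (simp add: mult.commute)
  also have "\<dots> \<le> 1 * (\<Sum>l\<in>L. log_bound P C n l)"
    using sum_weight_le_1[OF V(1,2)] P0 CA
    by (intro mult_right_mono sum_nonneg log_bound_nonneg) (auto simp: L_def)
  finally show ?thesis by (simp add: L_def ennreal_leI)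
qed

end

theorem theorem2p3:
  fixes M :: "'w measure" and N :: "'u measure"
    and X :: "'x \<Rightarrow> 'w \<Rightarrow> 'v" and \<X> :: "'x set"
    and \<A> \<B> :: "'w set set" and vbl rsp :: "'w set \<Rightarrow> 'x set" and prec :: "'w set rel"
    and P z :: "'w set \<Rightarrow> real" and T :: "nat \<Rightarrow> 'x \<Rightarrow> 'u \<Rightarrow> 'v"
  assumes setting: "resample_setting M X \<X> \<A> vbl rsp prec"
    and P_range: "\<And>A. A \<in> \<A> \<Longrightarrow> P A \<in> {0<..<1}"
    and z_range: "\<And>A. A \<in> \<A> \<Longrightarrow> z A \<in> {0<..<1}"
    and P_ge: "\<And>A. A \<in> \<A> \<Longrightarrow> P A \<ge> sup_cond_prob M X (stc vbl rsp A) A"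
    and P_le: "\<And>A. A \<in> \<A> \<Longrightarrow> P A \<le> z A * unordered_prod (\<lambda>B. 1 - z B) (nbhd \<A> rsp A)"
    and prob_N: "prob_space N"
    and samples: "independent_samples M X \<X> N T"
    and B: "finite \<B>" "\<B> \<subseteq> \<A>"
  defines "t \<equiv> (\<lambda>\<omega>. stop_time X \<A> vbl rsp prec \<B> (\<lambda>n x. T n x \<omega>))"
  shows "t \<in> measurable N (count_space UNIV) \<and> (\<integral>\<^sup>+ \<omega>. ennreal_of_enat (t \<omega>) \<partial>N) < \<infinity>"
proof
  interpret resample_process M X \<X> \<A> vbl rsp prec N T
    using setting prob_N samples
    by (intro resample_process.intro resample_process_axioms.intro)
  show t: "t \<in> measurable N (count_space UNIV)"
    unfolding t_def by (rule stop_time_measurable[OF B])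
  define C where "C = \<B> \<union> (\<Union>B\<in>\<B>. {A\<in>\<A>. (A, B) \<in> prec})"
  define c where "c n = (\<Sum>l\<in>insert None (Some ` C). log_bound P C n l)" for n
  have C: "finite C" "C \<subseteq> \<A>"
    unfolding C_def using B prec_omega by auto
  have P0: "0 \<le> P A" if "A \<in> \<A>" for A
    using P_range[OF that] by simp
  have c0: "0 \<le> c n" for n
    unfolding c_def using C(2) P0 by (intro sum_nonneg log_bound_nonneg) auto
  \<comment> \<open>The expectation is the sum of the tail probabilities, also when \<open>t\<close>
    may be infinite.\<close>
  have "(\<integral>\<^sup>+ \<omega>. ennreal_of_enat (t \<omega>) \<partial>N) = (\<Sum>n. emeasure N {\<omega>\<in>space N. enat n < t \<omega>})"
    using nn_integral_enat_function[OF t] by simp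
  also have "\<dots> \<le> (\<Sum>n. ennreal (c n))"
    unfolding c_def t_def using P0 P_ge by (intro suminf_le prob_running_le[OF B _ _ C_def]) auto
  \<comment> \<open>The product over \<open>C\<close> bounds all partial sums at once.\<close>
  also have "\<dots> \<le> ennreal (\<Prod>A\<in>C. 1 / (1 - z A))"
  proof (rule suminf_le_const)
    fix n
    have "(\<Sum>k<n. c k) \<le> (\<Prod>A\<in>C. 1 / (1 - z A))"
      unfolding c_def using P0 P_le z_range by (intro sum_log_bound_le C) auto
    then show "(\<Sum>k<n. ennreal (c k)) \<le> ennreal (\<Prod>A\<in>C. 1 / (1 - z A))"
      using c0 by (simp add: ennreal_leI)
  qed simp
  finally show "(\<integral>\<^sup>+ \<omega>. ennreal_of_enat (t \<omega>) \<partial>N) < \<infinity>"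
    using ennreal_less_top le_less_trans by (metis infinity_ennreal_def)
qed

end
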